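(* The set $\mathrm{Im}(o)$ is not dense in $[\frac{13}{6}, \infty)$; that is, it is not the case that every point of $[\frac{13}{6},\infty)$ is an adherent point (a point of the closure) of $\mathrm{Im}(o)\cap[\frac{13}{6},\infty)$.
   Context: For a finite group $G$ and $x\in G$, $o(x)$ denotes the order of the element $x$. The sum of element orders is $\psi(G)=\sum_{x\in G}o(x)$, and the average order of $G$ is $o(G)=\frac{\psi(G)}{|G|}$. $\mathrm{Im}(o)=\{o(G) \mid G\in\mathcal{G}\}\subset\mathbb{R}$, where $\mathcal{G}$ is the class of all finite groups. The topology is the usual topology on $\mathbb{R}$. *)

theory Defs
  imports
    "HOL-Analysis.Analysis"
    "HOL-Algebra.Multiplicative_Group"
begin

definition sum_element_orders :: "('a, 'b) monoid_scheme \<Rightarrow> nat"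
  where "sum_element_orders G = (\<Sum>x\<in>carrier G. group.ord G x)"

definition average_order :: "('a, 'b) monoid_scheme \<Rightarrow> real"
  where "average_order G = real (sum_element_orders G) / real (order G)"

(* The class of all finite groups is represented by the finite groups whose carrier is a
   set of natural numbers. This loses no values, since every finite group is isomorphic
   to one of these; see average_order_in_Im below. *)
definition Im_average_order :: "real set"
  where "Im_average_order =
    {average_order G | G :: nat monoid. group G \<and> finite (carrier G)}"

lemma average_order_iso:
  assumes "group G" "group H" "f \<in> iso G H"
  shows "average_order G = average_order H"
proof -
  interpret f: group_hom G H f
    using assms by (simp add: group_hom_def group_hom_axioms_def iso_def)
  have bij: "bij_betw f (carrier G) (carrier H)"
    using assms(3) by (simp add: iso_def)
  have ord_eq: "group.ord H (f x) = group.ord G x" if x: "x \<in> carrier G" for x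
  proof -
    have "(f x [^]\<^bsub>H\<^esub> n = \<one>\<^bsub>H\<^esub>) = (x [^]\<^bsub>G\<^esub> n = \<one>\<^bsub>G\<^esub>)" for n :: nat
      using bij x f.hom_nat_pow[OF x, of n] f.hom_one
        f.G.nat_pow_closed[OF x, of n] f.G.one_closed
      by (metis bij_betw_imp_inj_on inj_onD)
    then show ?thesis
      by (simp add: f.G.ord_def f.H.ord_def)
  qed
  have "sum_element_orders H = sum_element_orders G"
    unfolding sum_element_orders_def
    using sum.reindex_bij_betw[OF bij, of "group.ord H"] ord_eq by simp
  moreover have "order H = order G"
    using bij by (simp add: order_def bij_betw_same_card)
  ultimately show ?thesis
    by (simp add: average_order_def)
qed

lemma average_order_in_Im:
  fixes G :: "('a, 'b) monoid_scheme"
  assumes "group G" "finite (carrier G)"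
  shows "average_order G \<in> Im_average_order"
proof -
  interpret group G by fact
  obtain f :: "'a \<Rightarrow> nat" where f: "inj_on f (carrier G)"
    using assms(2) finite_imp_inj_to_nat_seg by metis
  define g where "g = inv_into (carrier G) f"
  define H :: "nat monoid" where
    "H = \<lparr>carrier = f ` carrier G, mult = (\<lambda>a b. f (g a \<otimes>\<^bsub>G\<^esub> g b)), one = f \<one>\<^bsub>G\<^esub>\<rparr>"
  have g: "g (f x) = x" if "x \<in> carrier G" for x
    using f that by (simp add: g_def)
  have iso: "f \<in> iso G H"
    using f by (auto simp: iso_def hom_def H_def bij_betw_def g)
  have "group (H\<lparr>one := f \<one>\<^bsub>G\<^esub>\<rparr>)"
    using iso_imp_img_group[OF iso] .
  then have "group H"
    by (simp add: H_def)
  moreover have "finite (carrier H)"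
    using assms(2) by (simp add: H_def)
  ultimately show ?thesis
    using average_order_iso[OF assms(1) _ iso] unfolding Im_average_order_def by blast
qed

end

theory Submission
  imports Defs
begin

text \<open>
  The open interval from \<open>13/6\<close> to \<open>13/6 + 1/144\<close> contains no average order at all, so its points
  are not adherent to the set of average orders.

  Let \<open>G\<close> be a finite group of order \<open>n\<close>, and let \<open>i\<close> be the number of its elements \<open>x\<close> with
  \<open>x\<^sup>2 = 1\<close>. All elements outside this set have order at least 3, and all elements but the identity
  have order at least 2, so the sum of the element orders is at least \<open>3n - i - 1\<close>. By a classical
  fact (\<open>square_one_if_many_square_one\<close>), either all elements satisfy \<open>x\<^sup>2 = 1\<close>, or \<open>i \<le> 3n/4\<close>.
  In the first case the average order is at most 2. In the second case it is at
  least \<open>9/4 - 1/n\<close>, which exceeds \<open>13/6 + 1/144\<close> as soon as \<open>n \<ge> 24\<close>. If \<open>n < 24\<close>, the average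
  order is a fraction with denominator \<open>n\<close>, and such a fraction larger than \<open>13/6\<close> exceeds it by at
  least \<open>1/(6n) > 1/144\<close>.
\<close>

context group
begin

lemma subgroup_eq_carrier_if_more_than_half:
  assumes "finite (carrier G)" "subgroup H G" "order G < 2 * card H"
  shows "H = carrier G"
proof -
  have *: "card (rcosets H) * card H = order G"
    using lagrange[OF assms(2)] .
  moreover have "order G > 0"
    using assms(1) order_gt_0_iff_finite by blast
  ultimately have "card (rcosets H) > 0" "card (rcosets H) < 2"
    using assms(3) by (auto intro: gr0I) (metis mult_less_cancel2)
  then have "card (rcosets H) = 1"
    by linarith
  then have "card H = card (carrier G)"
    using * by (simp add: order_def)
  then show ?thesis
    using assms(1) subgroup.subset[OF assms(2)] card_subset_eq by blast
qed

lemma subgroup_commuting_elements: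
  assumes a: "a \<in> carrier G"
  shows "subgroup {y \<in> carrier G. a \<otimes> y = y \<otimes> a} G"
proof (rule subgroupI)
  show "{y \<in> carrier G. a \<otimes> y = y \<otimes> a} \<noteq> {}"
    using a by auto
next
  fix y assume y: "y \<in> {y \<in> carrier G. a \<otimes> y = y \<otimes> a}"
  then have yG: "y \<in> carrier G" and ay: "a \<otimes> y = y \<otimes> a"
    by auto
  have "a \<otimes> inv y = inv y \<otimes> (y \<otimes> a) \<otimes> inv y"
    using a yG by (simp add: m_assoc[symmetric])
  also have "\<dots> = inv y \<otimes> (a \<otimes> y) \<otimes> inv y"
    by (simp only: ay)
  also have "\<dots> = inv y \<otimes> a"
    using yG a by (simp add: m_assoc)
  finally show "inv y \<in> {y \<in> carrier G. a \<otimes> y = y \<otimes> a}"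
    using yG by simp
next
  fix y z
  assume "y \<in> {y \<in> carrier G. a \<otimes> y = y \<otimes> a}" "z \<in> {y \<in> carrier G. a \<otimes> y = y \<otimes> a}"
  then show "y \<otimes> z \<in> {y \<in> carrier G. a \<otimes> y = y \<otimes> a}"
    using a by simp (metis m_assoc)
qed auto

lemma commute_if_squares_one:
  assumes "a \<in> carrier G" "y \<in> carrier G"
    and "a \<otimes> a = \<one>" "y \<otimes> y = \<one>" "(a \<otimes> y) \<otimes> (a \<otimes> y) = \<one>"
  shows "a \<otimes> y = y \<otimes> a"
proof -
  have "inv a = a" "inv y = y" "inv (a \<otimes> y) = a \<otimes> y"
    using assms by (simp_all add: inv_equality)
  then show ?thesis
    using assms(1,2) inv_mult_group by metis
qed

text \<open>
  If \<open>a\<^sup>2 = 1\<close> and more than three quarters of the elements square to the identity, then for more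
  than half of the elements \<open>y\<close> both \<open>y\<close> and \<open>a \<otimes> y\<close> square to the identity. Such a \<open>y\<close> commutes
  with \<open>a\<close>, so \<open>a\<close> is central.
  Hence more than half of the group is central, the group is abelian, and the elements that
  square to the identity form a subgroup, which is too large to be proper.
\<close>

lemma square_one_if_many_square_one:
  assumes fin: "finite (carrier G)"
    and many: "3 * order G < 4 * card {x \<in> carrier G. x \<otimes> x = \<one>}"
    and x: "x \<in> carrier G"
  shows "x \<otimes> x = \<one>"
proof -
  define I where "I = {x \<in> carrier G. x \<otimes> x = \<one>}"
  have I: "I \<subseteq> carrier G" "finite I"
    using fin by (auto simp: I_def)
  have large: "order G < 2 * card I"
    using many by (simp add: I_def)
  have central: "a \<otimes> y = y \<otimes> a" if a: "a \<in> I" and y: "y \<in> carrier G" for a y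
  proof -
    have aG: "a \<in> carrier G" "a \<otimes> a = \<one>"
      using a by (auto simp: I_def)
    \<comment> \<open>\<open>(\<otimes>) a ` I\<close> is the set of all \<open>y\<close> such that \<open>a \<otimes> y\<close> squares to the identity.\<close>
    define J where "J = (\<otimes>) a ` I"
    have J: "J \<subseteq> carrier G" "finite J"
      using aG I by (auto simp: J_def)
    have cardJ: "card J = card I"
      unfolding J_def using aG(1) by (intro card_image inj_onI) (simp add: I_def)
    have "card I + card J = card (I \<union> J) + card (I \<inter> J)"
      using I J card_Un_Int by blast
    moreover have "card (I \<union> J) \<le> order G"
      unfolding order_def using I J fin by (intro card_mono) auto
    ultimately have half: "order G < 2 * card (I \<inter> J)"
      using many cardJ by (simp add: I_def)
    have "I \<inter> J \<subseteq> {y \<in> carrier G. a \<otimes> y = y \<otimes> a}"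
    proof
      fix z assume z: "z \<in> I \<inter> J"
      then obtain w where w: "w \<in> I" "z = a \<otimes> w"
        by (auto simp: J_def)
      then have "a \<otimes> z = w"
        using aG I by (simp add: I_def m_assoc[symmetric])
      then show "z \<in> {y \<in> carrier G. a \<otimes> y = y \<otimes> a}"
        using z w aG commute_if_squares_one[of a z] by (simp add: I_def)
    qed
    then have "card (I \<inter> J) \<le> card {y \<in> carrier G. a \<otimes> y = y \<otimes> a}"
      using fin by (intro card_mono) auto
    then have "{y \<in> carrier G. a \<otimes> y = y \<otimes> a} = carrier G"
      using half aG fin
      by (intro subgroup_eq_carrier_if_more_than_half subgroup_commuting_elements) auto
    then show ?thesis
      using y by blast
  qed
  have commute: "y \<otimes> z = z \<otimes> y" if y: "y \<in> carrier G" and z: "z \<in> carrier G" for y z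
  proof -
    have "I \<subseteq> {z \<in> carrier G. y \<otimes> z = z \<otimes> y}"
      using I(1) central[OF _ y] by fastforce
    then have "card I \<le> card {z \<in> carrier G. y \<otimes> z = z \<otimes> y}"
      using fin by (intro card_mono) auto
    then have "{z \<in> carrier G. y \<otimes> z = z \<otimes> y} = carrier G"
      using large y fin
      by (intro subgroup_eq_carrier_if_more_than_half subgroup_commuting_elements) auto
    then show ?thesis
      using z by blast
  qed
  have "subgroup I G"
  proof (rule subgroupI)
    show "I \<noteq> {}"
      by (auto simp: I_def)
    show "inv y \<in> I" if "y \<in> I" for y
      using that by (auto simp: I_def inv_equality)
    show "y \<otimes> z \<in> I" if "y \<in> I" "z \<in> I" for y z
    proof -
      have yz: "y \<in> carrier G" "z \<in> carrier G" "y \<otimes> y = \<one>" "z \<otimes> z = \<one>"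
        using that by (auto simp: I_def)
      have "(y \<otimes> z) \<otimes> (y \<otimes> z) = (y \<otimes> z) \<otimes> (z \<otimes> y)"
        using commute yz by simp
      also have "\<dots> = y \<otimes> (z \<otimes> z) \<otimes> y"
        using yz(1,2) by (simp add: m_assoc)
      also have "\<dots> = \<one>"
        using yz by simp
      finally show ?thesis
        using yz by (simp add: I_def)
    qed
  qed (use I in auto)
  then have "I = carrier G"
    using large fin by (intro subgroup_eq_carrier_if_more_than_half)
  then show ?thesis
    using x by (auto simp: I_def)
qed

lemma ord_dvd_2_iff:
  assumes "x \<in> carrier G"
  shows "ord x dvd 2 \<longleftrightarrow> x \<otimes> x = \<one>"
proof -
  have "x [^] (2::nat) = x \<otimes> x"
    using assms by (simp add: numeral_2_eq_2)
  then show ?thesis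
    using pow_eq_id[OF assms, of 2] by simp
qed

lemma sum_element_orders_ge:
  assumes fin: "finite (carrier G)"
  shows "3 * order G \<le> sum_element_orders G + card {x \<in> carrier G. x \<otimes> x = \<one>} + 1"
proof -
  have ord_ge: "3 \<le> ord x + (if x \<otimes> x = \<one> then 1 else 0) + (if x = \<one> then 1 else 0)"
    if x: "x \<in> carrier G" for x
  proof -
    have "ord x > 0"
      using ord_ge_1[OF fin x] by simp
    moreover have "ord x \<noteq> 1" if "x \<noteq> \<one>"
      using that x ord_eq_1 by blast
    moreover have "\<not> ord x dvd 2" if "x \<otimes> x \<noteq> \<one>"
      using that x ord_dvd_2_iff by blast
    then have "ord x \<noteq> 1 \<and> ord x \<noteq> 2" if "x \<otimes> x \<noteq> \<one>"
      using that by fastforce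
    ultimately show ?thesis
      by (cases "x = \<one>"; cases "x \<otimes> x = \<one>") force+
  qed
  have "3 * order G = (\<Sum>x\<in>carrier G. 3)"
    by (simp add: order_def)
  also have "\<dots> \<le>
      (\<Sum>x\<in>carrier G. ord x + (if x \<otimes> x = \<one> then 1 else 0) + (if x = \<one> then 1 else 0))"
    using ord_ge by (rule sum_mono)
  also have "\<dots> = sum_element_orders G + card {x \<in> carrier G. x \<otimes> x = \<one>} + 1"
    using fin by (simp add: sum.distrib sum_element_orders_def sum.If_cases Int_def)
  finally show ?thesis .
qed

lemma sum_element_orders_le_if_all_square_one:
  assumes "\<And>x. x \<in> carrier G \<Longrightarrow> x \<otimes> x = \<one>"
  shows "sum_element_orders G \<le> 2 * order G"
proof -
  have "ord x \<le> 2" if "x \<in> carrier G" for x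
    using that assms ord_dvd_2_iff by (intro dvd_imp_le) auto
  then have "sum_element_orders G \<le> (\<Sum>x\<in>carrier G. 2)"
    unfolding sum_element_orders_def by (rule sum_mono)
  then show ?thesis
    by (simp add: order_def)
qed

lemma average_order_gap:
  assumes fin: "finite (carrier G)"
  shows "average_order G \<notin> {13/6 <..< 13/6 + 1/144}"
proof
  assume gap: "average_order G \<in> {13/6 <..< 13/6 + 1/144}"
  define n where "n = order G"
  define s where "s = sum_element_orders G"
  have n: "n > 0"
    using fin order_gt_0_iff_finite by (simp add: n_def)
  have "13/6 * real n < real s" "real s < (13/6 + 1/144) * real n"
    using gap n by (simp_all add: average_order_def n_def s_def field_simps)
  then have "real (13 * n) < real (6 * s)" "real (144 * s) < real (313 * n)"
    by (simp_all add: field_simps)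
  then have s: "13 * n < 6 * s" "144 * s < 313 * n"
    unfolding of_nat_less_iff by simp_all
  show False
  proof (cases "3 * n < 4 * card {x \<in> carrier G. x \<otimes> x = \<one>}")
    case True
    then have "s \<le> 2 * n"
      unfolding n_def s_def using fin square_one_if_many_square_one
      by (intro sum_element_orders_le_if_all_square_one) blast
    then show False
      using s(1) by linarith
  next
    case False
    \<comment> \<open>Now \<open>9 n \<le> 4 s + 4\<close>, so \<open>s < 313 n / 144\<close> forces \<open>n < 24\<close>; but together with
        \<open>13 n + 1 \<le> 6 s\<close> it also forces \<open>n > 24\<close>.\<close>
    then show False
      using sum_element_orders_ge[OF fin] s unfolding n_def[symmetric] s_def[symmetric]
      by linarith
  qed
qed

end

theorem corollary2p10:
  shows "\<not> (\<forall>x\<in>{13/6..}. x \<in> closure (Im_average_order \<inter> {13/6..}))"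
proof
  assume dense: "\<forall>x\<in>{13/6..}. x \<in> closure (Im_average_order \<inter> {13/6..})"
  define U :: "real set" where "U = {13/6 <..< 13/6 + 1/144}"
  have "U \<inter> Im_average_order = {}"
    unfolding U_def Im_average_order_def using group.average_order_gap by blast
  moreover have "open U"
    by (simp add: U_def)
  ultimately have "U \<inter> closure (Im_average_order \<inter> {13/6..}) = {}"
    using open_Int_closure_eq_empty[of U] by blast
  moreover have "(13/6 + 1/288 :: real) \<in> U" "(13/6 + 1/288 :: real) \<in> {13/6..}"
    by (simp_all add: U_def)
  ultimately show False
    using dense by blast
qed

end
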